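(* For integers $k\ge 8$ put $$S(k)=\begin{cases}(k-5)(k-6)(k-7)/24,&k\text{ odd},\\(k-4)(k-6)(k-8)/24,&k\text{ even},\end{cases}\qquad U_8(k)=\binom{k+2}{3}-S(k).$$ Every $(P_2\cup P_3)$-free graph $G$ with $k=\omega(G)\ge8$ satisfies $$\chi(G)\le U_8(k)\le\frac{k^3}{8}+\frac{5k^2}{4}-4k+8.$$ The second inequality is an equality for even $k$; for odd $k$, the difference between its right-hand side and $U_8(k)$ (that is, $\frac{k^3}{8}+\frac{5k^2}{4}-4k+8-U_8(k)$) equals $(k-6)/8$.
   Context: All graphs are finite, simple and undirected. $\chi(G)$ and $\omega(G)$ denote the chromatic number and the clique number of $G$. $P_t$ is the path on $t$ vertices, and $P_2\cup P_3$ is the graph consisting of an edge and a three-vertex path with no vertices in common and no edges between them. A graph is $H$-free if it has no induced subgraph isomorphic to $H$. *)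

theory Defs
  imports Complex_Main "Graph_Theory.Graph_Theory"
begin

text \<open>
  Finite simple undirected graphs are the \<^locale>\<open>pair_graph\<close>s of the library: finite, loopless
  graphs whose adjacency relation \<^const>\<open>parcs\<close> is symmetric, so that an edge \<open>uv\<close> is present as
  both \<open>(u, v)\<close> and \<open>(v, u)\<close>.
\<close>

definition path_graph :: "nat \<Rightarrow> nat pair_pre_digraph" where
  "path_graph t = \<lparr> pverts = {..<t}, parcs = {(i, j). i < t \<and> j < t \<and> (j = Suc i \<or> i = Suc j)} \<rparr>"

definition disjoint_union_graph ::
    "'a pair_pre_digraph \<Rightarrow> 'b pair_pre_digraph \<Rightarrow> ('a + 'b) pair_pre_digraph" where
  "disjoint_union_graph G H =
     \<lparr> pverts = pverts G <+> pverts H,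
       parcs = map_prod Inl Inl ` parcs G \<union> map_prod Inr Inr ` parcs H \<rparr>"

definition P2_union_P3 :: "(nat + nat) pair_pre_digraph" where
  "P2_union_P3 = disjoint_union_graph (path_graph 2) (path_graph 3)"

definition induced_free :: "'b pair_pre_digraph \<Rightarrow> 'a pair_pre_digraph \<Rightarrow> bool" where
  "induced_free H G \<longleftrightarrow>
     \<not> (\<exists>F. induced_subgraph F (with_proj G) \<and> digraph_iso F (with_proj H))"

definition is_clique :: "'a pair_pre_digraph \<Rightarrow> 'a set \<Rightarrow> bool" where
  "is_clique G K \<longleftrightarrow> K \<subseteq> pverts G \<and> (\<forall>u\<in>K. \<forall>v\<in>K. u \<noteq> v \<longrightarrow> (u, v) \<in> parcs G)"

definition clique_number :: "'a pair_pre_digraph \<Rightarrow> nat" where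
  "clique_number G = Max (card ` {K. is_clique G K})"

definition proper_colouring :: "'a pair_pre_digraph \<Rightarrow> nat \<Rightarrow> ('a \<Rightarrow> nat) \<Rightarrow> bool" where
  "proper_colouring G n c \<longleftrightarrow>
     c ` pverts G \<subseteq> {..<n} \<and> (\<forall>(u, v) \<in> parcs G. c u \<noteq> c v)"

definition chromatic_number :: "'a pair_pre_digraph \<Rightarrow> nat" where
  "chromatic_number G = (LEAST n. \<exists>c. proper_colouring G n c)"

text \<open>The subtractions and divisions below are those of the reals, hence not truncating.\<close>

definition S_term :: "nat \<Rightarrow> real" where
  "S_term k = (if odd k then (real k - 5) * (real k - 6) * (real k - 7) / 24
               else (real k - 4) * (real k - 6) * (real k - 8) / 24)"

definition U8 :: "nat \<Rightarrow> real" where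
  "U8 k = real ((k + 2) choose 3) - S_term k"

end

theory Submission
  imports Defs
begin

text \<open>
  The bound is proved by induction on the clique number \<open>k\<close>. Let \<open>A\<close> be a clique of size \<open>k\<close> and \<open>i \<in> A\<close>.
  The neighbours of \<open>i\<close> have clique number at most \<open>k - 1\<close>, so it remains to colour the
  non-neighbours of \<open>i\<close>.

  The common non-neighbours of the two ends of an edge induce no \<open>P\<^sub>3\<close>; they form a disjoint union of
  cliques, which needs only as many colours as its largest clique has vertices. Every non-neighbour
  of \<open>i\<close> misses another vertex of \<open>A\<close> or belongs to one independent set that contains \<open>i\<close>. Sorted by
  the first \<open>j \<in> A - {i}\<close> that they miss, the non-neighbours of \<open>i\<close> thus fall into classes that take
  \<open>1, 2, \<dots>, k\<close> colours, which gives \<open>k(k+1)/2\<close> for them and the classical bound \<open>(k + 2) choose 3\<close> for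
  the graph.

  The improvement is that a class can be made to cost at most \<open>s\<close> colours on average, where \<open>s\<close> is any
  number with \<open>2 * s \<ge> k + 2\<close>. A class is expensive only if, for its vertex \<open>j\<close>, the common
  non-neighbours of \<open>i\<close> and \<open>j\<close> contain a clique with more than \<open>s\<close> vertices. Let \<open>K\<^sub>j\<close> be a largest
  one. If another vertex \<open>m\<close> of \<open>A\<close> misses a vertex of \<open>K\<^sub>j\<close>, then the classes of \<open>j\<close> and \<open>m\<close> can be
  coloured together with \<open>k + 2\<close> colours (\<open>two_nonneighbourhoods_colourable\<close>); this rests on
  the fact that two cliques with union of clique number \<open>k\<close> can be coloured with \<open>k\<close> colours, a
  consequence of Hall's theorem (\<open>two_clique_colouring\<close>). The classes that are not expensive
  are dealt with first. When all remaining \<open>j\<close> are expensive and none of them has such an \<open>m\<close> among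
  the others, these others together with \<open>K\<^sub>j\<close> form a clique; then fewer than \<open>s\<close> vertices remain,
  and their classes are small anyway.

  Hence the non-neighbours of \<open>i\<close> can be coloured with \<open>\<Sum>v=1..k. min v s\<close> colours
  (\<open>nonneighbourhood_colourable\<close>). Taking \<open>s = (k + 8) div 2\<close>, which changes nothing for \<open>k \<le> 8\<close>, and
  summing over the induction gives \<open>U8 k\<close>.
\<close>

section \<open>Systems of distinct representatives\<close>

text \<open>Hall's marriage theorem, by induction on the number of sets: a proper subfamily for which the
  condition is tight is represented separately from the remaining sets; when there is none, any
  element of any set may be its representative.\<close>

lemma hall_sdr:
  fixes A :: "'i \<Rightarrow> 'c set"
  assumes "finite I" and "\<And>i. i \<in> I \<Longrightarrow> finite (A i)"
    and "\<And>J. J \<subseteq> I \<Longrightarrow> card J \<le> card (\<Union>i\<in>J. A i)"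
  shows "\<exists>R. inj_on R I \<and> (\<forall>i\<in>I. R i \<in> A i)"
  using assms
proof (induction "card I" arbitrary: I A rule: less_induct)
  case less
  note fin = less.prems(1,2) and hall = less.prems(3)
  have finU: "finite (\<Union>i\<in>J. A i)" if "J \<subseteq> I" for J
    using that fin by (meson finite_UN_I finite_subset subsetD)
  show ?case
  proof (cases "I = {}")
    case True
    then show ?thesis by simp
  next
    case False
    show ?thesis
    proof (cases "\<exists>J. J \<subset> I \<and> J \<noteq> {} \<and> card J = card (\<Union>i\<in>J. A i)")
      case True
      then obtain J where J: "J \<subset> I" "J \<noteq> {}" "card J = card (\<Union>i\<in>J. A i)"
        by blast
      let ?U = "\<Union>i\<in>J. A i"
      have finJ: "finite J" and cJ: "card J < card I"
        using J(1) fin(1) finite_subset psubset_card_mono by blast+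
      have "\<exists>R. inj_on R J \<and> (\<forall>i\<in>J. R i \<in> A i)"
        using J(1) by (intro less.hyps cJ finJ fin hall) auto
      then obtain R where R: "inj_on R J" "\<forall>i\<in>J. R i \<in> A i" by blast
      have "\<exists>R. inj_on R (I - J) \<and> (\<forall>i\<in>I - J. R i \<in> A i - ?U)"
      proof (rule less.hyps)
        show "card (I - J) < card I"
          using J fin(1) by (intro psubset_card_mono) auto
        show "finite (I - J)" using fin by simp
        show "finite (A i - ?U)" if "i \<in> I - J" for i using fin that by simp
        show "card S \<le> card (\<Union>i\<in>S. A i - ?U)" if S: "S \<subseteq> I - J" for S
        proof -
          have finS: "finite S" using S fin(1) finite_subset by blast
          have "card S + card J = card (S \<union> J)"
            using S finS finJ by (subst card_Un_disjoint) auto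
          also have "\<dots> \<le> card (\<Union>i\<in>S \<union> J. A i)"
            using S J by (intro hall) auto
          also have "(\<Union>i\<in>S \<union> J. A i) = (\<Union>i\<in>S. A i - ?U) \<union> ?U"
            by auto
          also have "card \<dots> \<le> card (\<Union>i\<in>S. A i - ?U) + card ?U"
            by (rule card_Un_le)
          finally show ?thesis using J(3) by simp
        qed
      qed
      then obtain R' where R': "inj_on R' (I - J)" "\<forall>i\<in>I - J. R' i \<in> A i - ?U"
        by blast
      define Q where "Q i = (if i \<in> J then R i else R' i)" for i
      have "inj_on Q I"
      proof (rule inj_onI)
        fix a b assume ab: "a \<in> I" "b \<in> I" "Q a = Q b"
        have "Q c \<in> ?U \<longleftrightarrow> c \<in> J" if "c \<in> I" for c
          using that R(2) R'(2) unfolding Q_def by (cases "c \<in> J") force+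
        then have "a \<in> J \<longleftrightarrow> b \<in> J" using ab by metis
        then show "a = b"
          using ab inj_onD[OF R(1), of a b] inj_onD[OF R'(1), of a b]
          unfolding Q_def by (cases "a \<in> J") auto
      qed
      moreover have "\<forall>i\<in>I. Q i \<in> A i" using R R' unfolding Q_def by auto
      ultimately show ?thesis by blast
    next
      case noJ: False
      obtain a where a: "a \<in> I" using False by blast
      have "A a \<noteq> {}" using hall[of "{a}"] a by auto
      then obtain c where c: "c \<in> A a" by blast
      have "\<exists>R. inj_on R (I - {a}) \<and> (\<forall>i\<in>I - {a}. R i \<in> A i - {c})"
      proof (rule less.hyps)
        show "card (I - {a}) < card I"
          using a fin(1) by (intro psubset_card_mono) auto
        show "finite (I - {a})" using fin by simp
        show "finite (A i - {c})" if "i \<in> I - {a}" for i using fin that by simp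
        show "card S \<le> card (\<Union>i\<in>S. A i - {c})" if S: "S \<subseteq> I - {a}" for S
        proof (cases "S = {}")
          case False
          have "S \<subset> I" using S a by auto
          then have "card S < card (\<Union>i\<in>S. A i)"
            using noJ False hall[of S] by (metis le_neq_implies_less psubset_imp_subset)
          moreover have "(\<Union>i\<in>S. A i - {c}) = (\<Union>i\<in>S. A i) - {c}" by auto
          moreover have "card (\<Union>i\<in>S. A i) - 1 \<le> card ((\<Union>i\<in>S. A i) - {c})"
            using diff_card_le_card_Diff[of "{c}" "\<Union>i\<in>S. A i"] by simp
          ultimately show ?thesis by simp
        qed simp
      qed
      then obtain R where R: "inj_on R (I - {a})" "\<forall>i\<in>I - {a}. R i \<in> A i - {c}"
        by blast
      have "inj_on (R(a := c)) I"
        using R unfolding inj_on_def by auto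
      moreover have "\<forall>i\<in>I. (R(a := c)) i \<in> A i" using R c by auto
      ultimately show ?thesis by blast
    qed
  qed
qed

text \<open>Two cliques \<open>X\<close> and \<open>Y\<close> joined by \<open>r\<close> can be coloured with as many colours as the largest
  clique has vertices: a colouring of \<open>X\<close> extends to \<open>Y\<close>, since Hall's condition for the colours
  still allowed at the vertices of \<open>Y\<close> is the bound on the size of a clique. Only the relation
  between the two sides enters, so that it can be changed before the lemma is applied.\<close>

lemma two_clique_colouring:
  fixes r :: "'a \<Rightarrow> 'b \<Rightarrow> bool" and f :: "'a \<Rightarrow> nat"
  assumes "finite X" "finite Y" and f: "inj_on f X" "f ` X \<subseteq> {..<k}"
    and bound: "\<And>S. S \<subseteq> Y \<Longrightarrow> S \<noteq> {} \<Longrightarrow> card S + card {x \<in> X. \<forall>y\<in>S. r x y} \<le> k"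
  shows "\<exists>g. inj_on g Y \<and> g ` Y \<subseteq> {..<k} \<and> (\<forall>x\<in>X. \<forall>y\<in>Y. r x y \<longrightarrow> f x \<noteq> g y)"
proof -
  define A where "A y = {..<k} - f ` {x \<in> X. r x y}" for y
  have "\<exists>g. inj_on g Y \<and> (\<forall>y\<in>Y. g y \<in> A y)"
  proof (rule hall_sdr)
    fix S assume S: "S \<subseteq> Y"
    show "card S \<le> card (\<Union>y\<in>S. A y)"
    proof (cases "S = {}")
      case False
      have "(\<Inter>y\<in>S. f ` {x \<in> X. r x y}) \<subseteq> f ` {x \<in> X. \<forall>y\<in>S. r x y}"
      proof
        fix c assume c: "c \<in> (\<Inter>y\<in>S. f ` {x \<in> X. r x y})"
        then obtain x where x: "x \<in> X" "c = f x" using False by blast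
        have "r x y" if "y \<in> S" for y
          using c x that inj_onD[OF f(1)] by blast
        then show "c \<in> f ` {x \<in> X. \<forall>y\<in>S. r x y}" using x by blast
      qed
      then have "(\<Union>y\<in>S. A y) = {..<k} - f ` {x \<in> X. \<forall>y\<in>S. r x y}"
        using False unfolding A_def by blast
      moreover have "card (f ` {x \<in> X. \<forall>y\<in>S. r x y}) = card {x \<in> X. \<forall>y\<in>S. r x y}"
        using f(1) by (intro card_image) (auto intro: inj_on_subset)
      moreover have "f ` {x \<in> X. \<forall>y\<in>S. r x y} \<subseteq> {..<k}" using f(2) by auto
      ultimately have "card (\<Union>y\<in>S. A y) = k - card {x \<in> X. \<forall>y\<in>S. r x y}"
        using assms(1) by (simp add: card_Diff_subset)
      then show ?thesis using bound[OF S False] by simp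
    qed simp
  qed (use assms in \<open>auto simp: A_def\<close>)
  then obtain g where g: "inj_on g Y" "\<forall>y\<in>Y. g y \<in> A y" by blast
  then show ?thesis unfolding A_def by (intro exI[of _ g] conjI) (blast, blast, force)
qed

section \<open>Colourings and cliques\<close>

text \<open>A graph given by its adjacency relation on the whole type; vertex sets are passed around
  separately, and stand for the subgraphs that they induce.\<close>

locale adjacency =
  fixes E :: "'a \<Rightarrow> 'a \<Rightarrow> bool"
  assumes sym: "E u v \<Longrightarrow> E v u" and irrefl: "\<not> E u u"
begin

text \<open>\<open>S\<close> has a proper colouring with the \<open>n\<close> colours below \<open>n\<close>.\<close>

definition colourable :: "'a set \<Rightarrow> nat \<Rightarrow> bool" where
  "colourable S n \<longleftrightarrow> (\<exists>f. f ` S \<subseteq> {..<n} \<and> (\<forall>u\<in>S. \<forall>v\<in>S. E u v \<longrightarrow> f u \<noteq> f v))"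

text \<open>Pairwise adjacent vertices; the empty set is a clique.\<close>

definition clique :: "'a set \<Rightarrow> bool" where
  "clique K \<longleftrightarrow> (\<forall>u\<in>K. \<forall>v\<in>K. u \<noteq> v \<longrightarrow> E u v)"

text \<open>The clique number of \<open>S\<close> is at most \<open>n\<close>.\<close>

definition clique_bound :: "'a set \<Rightarrow> nat \<Rightarrow> bool" where
  "clique_bound S n \<longleftrightarrow> (\<forall>K\<subseteq>S. clique K \<longrightarrow> card K \<le> n)"

text \<open>No induced path on three vertices; equivalently, a disjoint union of cliques with no edges
  between them.\<close>

definition P3_free :: "'a set \<Rightarrow> bool" where
  "P3_free S \<longleftrightarrow> (\<forall>x\<in>S. \<forall>y\<in>S. \<forall>z\<in>S. E x y \<longrightarrow> E y z \<longrightarrow> x \<noteq> z \<longrightarrow> E x z)"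

lemma P3_freeD: "P3_free S \<Longrightarrow> x \<in> S \<Longrightarrow> y \<in> S \<Longrightarrow> z \<in> S \<Longrightarrow> E x y \<Longrightarrow> E y z \<Longrightarrow> x \<noteq> z \<Longrightarrow> E x z"
  unfolding P3_free_def
  by (drule bspec, assumption, drule bspec, assumption, drule bspec, assumption) iprover

lemma P3_free_subset: "P3_free T \<Longrightarrow> S \<subseteq> T \<Longrightarrow> P3_free S"
  unfolding P3_free_def by blast

lemma cliqueD: "clique K \<Longrightarrow> u \<in> K \<Longrightarrow> v \<in> K \<Longrightarrow> u \<noteq> v \<Longrightarrow> E u v"
  by (simp add: clique_def)

lemma clique_subset: "clique T \<Longrightarrow> S \<subseteq> T \<Longrightarrow> clique S"
  unfolding clique_def by blast

lemma clique_empty: "clique {}"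
  unfolding clique_def by blast

lemma clique_Un:
  assumes "clique K" "clique L" "\<And>x y. x \<in> K \<Longrightarrow> y \<in> L \<Longrightarrow> x \<noteq> y \<Longrightarrow> E x y"
  shows "clique (K \<union> L)"
  unfolding clique_def
proof (intro ballI impI)
  fix u v assume "u \<in> K \<union> L" "v \<in> K \<union> L" "u \<noteq> v"
  then consider "u \<in> K" "v \<in> K" | "u \<in> L" "v \<in> L" | "u \<in> K" "v \<in> L" | "v \<in> K" "u \<in> L"
    by blast
  then show "E u v"
    using assms(1,2) assms(3)[of u v] sym[OF assms(3), of v u] \<open>u \<noteq> v\<close>
    unfolding clique_def by cases auto
qed

lemma clique_boundD: "clique_bound S n \<Longrightarrow> K \<subseteq> S \<Longrightarrow> clique K \<Longrightarrow> card K \<le> n"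
  by (simp add: clique_bound_def)

lemma clique_bound_mono: "clique_bound T m \<Longrightarrow> S \<subseteq> T \<Longrightarrow> m \<le> n \<Longrightarrow> clique_bound S n"
  unfolding clique_bound_def by (metis le_trans subset_trans)

lemma colourable_mono:
  assumes "colourable T m" "S \<subseteq> T" "m \<le> n"
  shows "colourable S n"
proof -
  obtain f where f: "f ` T \<subseteq> {..<m}" "\<forall>u\<in>T. \<forall>v\<in>T. E u v \<longrightarrow> f u \<noteq> f v"
    using assms(1) unfolding colourable_def by blast
  have "f ` S \<subseteq> {..<n}" using f(1) assms(2,3) by fastforce
  then show ?thesis using f(2) assms(2) unfolding colourable_def by (intro exI[of _ f]) auto
qed

lemma colourable_Un:
  assumes "colourable S m" "colourable T n"
  shows "colourable (S \<union> T) (m + n)"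
proof -
  obtain f where f: "f ` S \<subseteq> {..<m}" "\<forall>u\<in>S. \<forall>v\<in>S. E u v \<longrightarrow> f u \<noteq> f v"
    using assms(1) unfolding colourable_def by blast
  obtain g where g: "g ` T \<subseteq> {..<n}" "\<forall>u\<in>T. \<forall>v\<in>T. E u v \<longrightarrow> g u \<noteq> g v"
    using assms(2) unfolding colourable_def by blast
  define h where "h u = (if u \<in> S then f u else m + g u)" for u
  have S: "h u = f u" "h u < m" if "u \<in> S" for u
    using f(1) that unfolding h_def by auto
  have T: "u \<in> T" "h u = m + g u" "g u < n" if "u \<in> S \<union> T" "u \<notin> S" for u
    using g(1) that unfolding h_def by auto
  show ?thesis unfolding colourable_def
  proof (intro exI[of _ h] conjI ballI impI)
    have "h u < m + n" if "u \<in> S \<union> T" for u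
      using S[of u] T[of u] that by (cases "u \<in> S") simp_all
    then show "h ` (S \<union> T) \<subseteq> {..<m + n}" by blast
    fix u v assume uv: "u \<in> S \<union> T" "v \<in> S \<union> T" "E u v"
    consider "u \<in> S" "v \<in> S" | "u \<in> S" "v \<notin> S" | "u \<notin> S" "v \<in> S" | "u \<notin> S" "v \<notin> S"
      by blast
    then show "h u \<noteq> h v"
    proof cases
      case 1
      then show ?thesis using f(2) uv(3) S(1) by metis
    next
      case 2
      then show ?thesis using S(2)[of u] T(2)[OF uv(2)] by simp
    next
      case 3
      then show ?thesis using S(2)[of v] T(2)[OF uv(1)] by simp
    next
      case 4
      then show ?thesis
        using g(2) uv(3) T(1,2)[OF uv(1)] T(1,2)[OF uv(2)] by (metis add_left_cancel)
    qed
  qed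
qed

lemma edgeless_colourable:
  assumes "\<And>u v. u \<in> S \<Longrightarrow> v \<in> S \<Longrightarrow> \<not> E u v"
  shows "colourable S 1"
  unfolding colourable_def using assms by (intro exI[of _ "\<lambda>_. 0"]) auto

lemma maximum_clique:
  assumes "finite S"
  obtains K where "K \<subseteq> S" "clique K" "clique_bound S (card K)"
proof -
  let ?C = "{K. K \<subseteq> S \<and> clique K}"
  have "finite ?C" "?C \<noteq> {}" using assms clique_empty by auto
  then have "Max (card ` ?C) \<in> card ` ?C" by (intro Max_in) auto
  then obtain K where K: "K \<in> ?C" "Max (card ` ?C) = card K" by blast
  have "card L \<le> card K" if "L \<in> ?C" for L
  proof -
    have "card L \<le> Max (card ` ?C)" using \<open>finite ?C\<close> that by (intro Max_ge) auto
    then show ?thesis unfolding K(2) .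
  qed
  then show ?thesis
    using K(1) by (intro that[of K]) (simp_all add: clique_bound_def)
qed

text \<open>The components of \<open>N - K\<close> are cliques, and each of them is coloured by itself as an extension
  of one fixed colouring of \<open>K\<close>.\<close>

lemma clique_union_P3_free_colourable:
  assumes K: "clique K" "finite K" and N: "P3_free N" "finite N"
    and bound: "clique_bound (K \<union> N) k"
  shows "colourable (K \<union> N) k"
proof -
  have "card K \<le> k" using bound K unfolding clique_bound_def by blast
  then obtain f where f: "inj_on f K" "f ` K \<subseteq> {..<k}"
    using card_le_inj[of K "{..<k}"] K(2) by auto
  define comp where "comp v = {u \<in> N - K. u = v \<or> E v u}" for v
  have comp_eq: "comp u = comp v" if "u \<in> N - K" "v \<in> N - K" "E u v" for u v
  proof -
    have "w = u \<or> E u w \<longleftrightarrow> w = v \<or> E v w" if "w \<in> N - K" for w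
      using that \<open>u \<in> N - K\<close> \<open>v \<in> N - K\<close> \<open>E u v\<close> sym[OF \<open>E u v\<close>]
        P3_freeD[OF N(1), of u v w] P3_freeD[OF N(1), of v u w] by (metis DiffD1)
    then show ?thesis unfolding comp_def by (intro Collect_cong conj_cong refl) auto
  qed
  have comp_clique: "clique (comp v)" if "v \<in> N - K" for v
    unfolding clique_def
  proof (intro ballI impI)
    fix a b assume "a \<in> comp v" "b \<in> comp v" "a \<noteq> b"
    then show "E a b"
      using that P3_freeD[OF N(1), of a v b] sym[of v a] unfolding comp_def by auto
  qed
  define good where "good v g \<longleftrightarrow> inj_on g (comp v) \<and> g ` comp v \<subseteq> {..<k} \<and>
      (\<forall>x\<in>K. \<forall>y\<in>comp v. E x y \<longrightarrow> f x \<noteq> g y)" for v and g :: "'a \<Rightarrow> nat"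
  have ex: "\<exists>g. good v g" if v: "v \<in> N - K" for v
    unfolding good_def
  proof (rule two_clique_colouring[OF K(2) _ f])
    show "finite (comp v)" using N(2) unfolding comp_def by simp
    fix S assume S: "S \<subseteq> comp v" "S \<noteq> {}"
    let ?X = "{x \<in> K. \<forall>y\<in>S. E x y}"
    have "clique (S \<union> ?X)"
      using clique_subset[OF comp_clique[OF v] S(1)] clique_subset[OF K(1), of ?X]
      by (intro clique_Un) (auto intro: sym)
    then have "card (S \<union> ?X) \<le> k"
      using S(1) unfolding comp_def by (intro clique_boundD[OF bound]) auto
    moreover have "card (S \<union> ?X) = card S + card ?X"
      using S(1) K(2) N(2) unfolding comp_def
      by (intro card_Un_disjoint) (auto intro: finite_subset)
    ultimately show "card S + card ?X \<le> k" by simp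
  qed
  define G where "G v = (SOME g. good v g)" for v
  have G: "good v (G v)" if "v \<in> N - K" for v
    unfolding G_def using ex[OF that] by (rule someI_ex)
  \<comment> \<open>Adjacent vertices have the same component, hence the same chosen colouring of it.\<close>
  have G_eq: "G u = G v" if "u \<in> N - K" "v \<in> N - K" "E u v" for u v
    using comp_eq[OF that] unfolding G_def good_def by simp
  define h where "h v = (if v \<in> K then f v else G v v)" for v
  have KN: "f u \<noteq> G v v" if "u \<in> K" "v \<in> N - K" "E u v" for u v
    using G[OF that(2)] that unfolding good_def comp_def by blast
  have NN: "G u u \<noteq> G v v" if "u \<in> N - K" "v \<in> N - K" "E u v" for u v
  proof -
    have "u \<in> comp v" "v \<in> comp v" "u \<noteq> v"
      using that sym[OF that(3)] irrefl unfolding comp_def by auto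
    then show ?thesis
      using G[OF that(2)] G_eq[OF that] unfolding good_def by (metis inj_onD)
  qed
  show ?thesis unfolding colourable_def
  proof (intro exI[of _ h] conjI ballI impI)
    have "G v v < k" if "v \<in> N - K" for v
      using G[OF that] that unfolding good_def comp_def by blast
    then show "h ` (K \<union> N) \<subseteq> {..<k}" using f(2) unfolding h_def by auto
    fix u v assume uv: "u \<in> K \<union> N" "v \<in> K \<union> N" "E u v"
    have "f u \<noteq> f v" if "u \<in> K" "v \<in> K"
      using f(1) that uv irrefl unfolding inj_on_def by blast
    then show "h u \<noteq> h v"
      using uv KN[of u v] KN[of v u] NN[of u v] sym[OF uv(3)] unfolding h_def
      by (cases "u \<in> K"; cases "v \<in> K") simp_all
  qed
qed

lemma P3_free_colourable:
  assumes "P3_free N" "finite N" "clique_bound N k"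
  shows "colourable N k"
  using clique_union_P3_free_colourable[of "{}" N k] assms clique_empty by simp

lemma P3_free_colouring_into:
  fixes C :: "nat set"
  assumes "P3_free N" "finite N" "clique_bound N (card C)" "finite C"
  shows "\<exists>h. h ` N \<subseteq> C \<and> (\<forall>u\<in>N. \<forall>v\<in>N. E u v \<longrightarrow> h u \<noteq> h v)"
proof -
  obtain f where f: "f ` N \<subseteq> {..<card C}" "\<forall>u\<in>N. \<forall>v\<in>N. E u v \<longrightarrow> f u \<noteq> f v"
    using P3_free_colourable[OF assms(1-3)] unfolding colourable_def by blast
  obtain b where "bij_betw b {..<card C} C"
    using ex_bij_betw_nat_finite[OF assms(4)] by (auto simp: atLeast0LessThan)
  then have b: "b ` {..<card C} = C" "inj_on b {..<card C}"
    unfolding bij_betw_def by auto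
  show ?thesis
  proof (intro exI[of _ "b \<circ> f"] conjI ballI impI)
    show "(b \<circ> f) ` N \<subseteq> C" using f(1) b(1) by auto
    fix u v assume "u \<in> N" "v \<in> N" "E u v"
    then show "(b \<circ> f) u \<noteq> (b \<circ> f) v"
      using f inj_onD[OF b(2), of "f u" "f v"] by (auto simp: image_subset_iff)
  qed
qed

end

section \<open>Non-neighbourhoods of two edges that share a vertex\<close>

text \<open>The premises of \<open>no_P2_P3\<close> force the five vertices to be distinct, except for \<open>c\<close> and \<open>e\<close>:
  for instance \<open>a = d\<close> would make \<open>a\<close> adjacent to \<open>c\<close>.\<close>

locale P2_union_P3_free_graph = adjacency E for E :: "'a \<Rightarrow> 'a \<Rightarrow> bool" +
  fixes V :: "'a set"
  assumes finite_V: "finite V"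
    and no_P2_P3: "\<lbrakk>a \<in> V; b \<in> V; c \<in> V; d \<in> V; e \<in> V; E a b; E c d; E d e; c \<noteq> e; \<not> E c e;
      \<not> E a c; \<not> E a d; \<not> E a e; \<not> E b c; \<not> E b d; \<not> E b e\<rbrakk> \<Longrightarrow> False"
begin

lemma not_sym: "\<not> E u v \<Longrightarrow> \<not> E v u"
  using sym by blast

text \<open>The induced \<open>P\<^sub>2 \<union> P\<^sub>3\<close> with edge \<open>ab\<close> and path \<open>cde\<close>, non-adjacencies read from the path.\<close>

lemma no_P3_P2:
  assumes "c \<in> V" "d \<in> V" "e \<in> V" "a \<in> V" "b \<in> V" "E c d" "E d e" "c \<noteq> e" "\<not> E c e" "E a b"
    "\<not> E c a" "\<not> E c b" "\<not> E d a" "\<not> E d b" "\<not> E e a" "\<not> E e b"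
  shows False
  by (rule no_P2_P3[of a b c d e]) (use assms not_sym in blast)+

lemma nonneighbours_of_edge_P3_free:
  assumes "a \<in> V" "b \<in> V" "E a b" "S \<subseteq> V" "\<And>x. x \<in> S \<Longrightarrow> \<not> E a x" "\<And>x. x \<in> S \<Longrightarrow> \<not> E b x"
  shows "P3_free S"
  unfolding P3_free_def
proof (intro ballI impI, rule ccontr)
  fix x y z assume *: "x \<in> S" "y \<in> S" "z \<in> S" "E x y" "E y z" "x \<noteq> z" "\<not> E x z"
  show False
    by (rule no_P2_P3[OF assms(1,2), of x y z]) (use * assms in blast)+
qed

text \<open>The main step. The two sets are the common non-neighbours of the edges \<open>ij\<close> and \<open>im\<close> of a
  triangle. Each is a disjoint union of cliques, and colouring them separately could take \<open>2k\<close>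
  colours; if \<open>m\<close> misses a vertex \<open>y\<close> of a largest clique \<open>K\<close> in the first set, then almost half of
  them are saved.

  If \<open>m\<close> misses a second vertex of \<open>K\<close>, then it misses everything in \<open>M - K\<close>, and \<open>M \<union> N\<close> is the
  union of the clique \<open>K\<close> and of \<open>N\<close>. Otherwise \<open>M \<inter> N\<close> is independent, and the rest consists of
  \<open>K' = K - {y}\<close>, of \<open>L = M - K - N\<close>, and of the neighbours \<open>Q\<close> and the non-neighbours \<open>P\<close> of \<open>y\<close> in
  \<open>N - M\<close>. There \<open>K'\<close> is complete to \<open>P\<close> and anticomplete to \<open>L\<close>, while \<open>Q\<close> is complete to \<open>L\<close> and
  anticomplete to \<open>P\<close>. Hence, with \<open>Y\<close> and \<open>Z\<close> largest cliques of \<open>L\<close> and \<open>P\<close>, it is enough to colour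
  the two cliques \<open>K' \<union> Z\<close> and \<open>Q \<union> Y\<close>, and to reuse the colours of \<open>Y\<close> on \<open>L\<close> and those of \<open>Z\<close> on
  \<open>P\<close>.\<close>

lemma two_nonneighbourhoods_colourable:
  fixes W :: "'a set"
  assumes W: "W \<subseteq> V" "clique_bound W k"
    and ijm: "i \<in> V" "j \<in> V" "m \<in> V" "E i j" "E i m" "E j m"
    and M_def: "M = {x \<in> W. \<not> E i x \<and> \<not> E j x}" and N_def: "N = {x \<in> W. \<not> E i x \<and> \<not> E m x}"
    and K: "K \<subseteq> M" "clique K" "clique_bound M (card K)"
    and y: "y \<in> K" "\<not> E m y"
  shows "colourable (M \<union> N) (k + 2)"
proof -
  have MW: "M \<subseteq> W" and NW: "N \<subseteq> W" and yM: "y \<in> M" and yN: "y \<in> N"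
    using K(1) y unfolding M_def N_def by auto
  have MV: "x \<in> V" "\<not> E i x" "\<not> E j x" if "x \<in> M" for x
    using that W(1) unfolding M_def by auto
  have NV: "x \<in> V" "\<not> E i x" "\<not> E m x" if "x \<in> N" for x
    using that W(1) unfolding N_def by auto
  have fin: "finite M" "finite N" "finite K"
    using MW NW W(1) K(1) finite_V by (meson finite_subset order_trans)+
  have P3M: "P3_free M"
    by (rule nonneighbours_of_edge_P3_free[OF ijm(1,2,4)]) (use MV in auto)
  have P3N: "P3_free N"
    by (rule nonneighbours_of_edge_P3_free[OF ijm(1,3,5)]) (use NV in auto)
  \<comment> \<open>As a largest clique, \<open>K\<close> is a whole component of \<open>M\<close>.\<close>
  have isolated: "\<not> E x z" if x: "x \<in> M - K" and z: "z \<in> K" for x z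
  proof
    assume "E x z"
    have "E x w" if "w \<in> K" for w
    proof (cases "w = z")
      case False
      then have "E z w" using cliqueD[OF K(2), of z w] z that by simp
      moreover have "x \<in> M" "z \<in> M" "w \<in> M" "x \<noteq> w" using x z that K(1) by auto
      ultimately show ?thesis using P3_freeD[OF P3M, of x z w] \<open>E x z\<close> by simp
    qed (use \<open>E x z\<close> in simp)
    then have "E w x" if "w \<in> K" for w using that sym by blast
    then have "clique (K \<union> {x})"
      using K(2) by (intro clique_Un) (auto simp: clique_def)
    then have "card (K \<union> {x}) \<le> card K"
      using x K(1) by (intro clique_boundD[OF K(3)]) auto
    then show False using x fin(3) by simp
  qed
  show ?thesis
  proof (cases "\<exists>y'\<in>K. y' \<noteq> y \<and> \<not> E m y'")
    case True
    then obtain y' where y': "y' \<in> K" "y' \<noteq> y" "\<not> E m y'" by blast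
    have yy': "E y y'" using cliqueD[OF K(2), of y y'] y(1) y'(1,2) by simp
    have "x \<in> N" if x: "x \<in> M - K" for x
    proof (rule ccontr)
      assume "x \<notin> N"
      then have "E m x" using x unfolding M_def N_def by blast
      moreover have "x \<noteq> i" using MV(3)[of x] x sym[OF ijm(4)] by blast
      moreover have "y' \<in> M" "x \<in> M" using y'(1) x K(1) by auto
      \<comment> \<open>The path \<open>imx\<close> avoids the edge \<open>yy'\<close>.\<close>
      ultimately show False
        using no_P3_P2[of i m x y y'] MV[OF yM] MV[of y'] MV[of x] isolated[OF x y(1)]
          isolated[OF x y'(1)] y(2) y'(3) yy' ijm(1,3,5) by simp
    qed
    then have "M \<union> N = K \<union> N" using K(1) by blast
    moreover have "clique_bound (K \<union> N) k"
      using K(1) MW NW by (intro clique_bound_mono[OF W(2)]) auto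
    ultimately have "colourable (M \<union> N) k"
      using clique_union_P3_free_colourable[OF K(2) fin(3) P3N fin(2)] by simp
    then show ?thesis by (rule colourable_mono) auto
  next
    case False
    then have mK: "E m x" if "x \<in> K - {y}" for x using that by blast
    define Q where "Q = {q \<in> N - M. E y q}"
    define P where "P = {p \<in> N - M. \<not> E y p}"
    define L where "L = M - K - N"
    define K' where "K' = K - {y}"
    have subW: "K' \<subseteq> W" "Q \<subseteq> W" "L \<subseteq> W" "P \<subseteq> W"
      using K(1) MW NW unfolding Q_def P_def L_def K'_def by auto
    have fins: "finite K'" "finite Q" "finite L" "finite P"
      using fin unfolding Q_def P_def L_def K'_def by auto
    have disj: "K' \<inter> Q = {}" "K' \<inter> L = {}" "K' \<inter> P = {}" "Q \<inter> L = {}" "Q \<inter> P = {}" "L \<inter> P = {}"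
      using K(1) unfolding Q_def P_def L_def K'_def by auto
    have NM: "E j q" "q \<noteq> i" if "q \<in> N - M" for q
      using that sym[OF ijm(5)] unfolding M_def N_def by auto
    have R: "colourable (M \<inter> N) 1"
    proof (rule edgeless_colourable)
      fix r r' assume r: "r \<in> M \<inter> N" "r' \<in> M \<inter> N"
      show "\<not> E r r'"
      proof
        assume rr': "E r r'"
        have notK: "s \<notin> K" if "s \<in> M \<inter> N" "s' \<in> M \<inter> N" "E s s'" for s s'
        proof
          assume "s \<in> K"
          then have "s = y" using mK NV(3) that(1) by blast
          then have "s' \<in> K"
            using isolated[of s' y] that(2) y(1) sym[OF that(3)] by blast
          then have "s' = y" using mK NV(3) that(2) by blast
          then show False using \<open>s = y\<close> that(3) irrefl by simp
        qed
        have nK: "r \<in> M - K" "r' \<in> M - K" using notK[OF r rr'] notK[OF r(2,1) sym[OF rr']] r by auto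
        have "clique {r, r'}" using rr' sym[OF rr'] unfolding clique_def by auto
        then have "card {r, r'} \<le> card K" using r by (intro clique_boundD[OF K(3)]) auto
        moreover have "r \<noteq> r'" using rr' irrefl by blast
        ultimately have "K \<noteq> {y}" by auto
        then obtain x where x: "x \<in> K" "x \<noteq> y" using y(1) by blast
        have "x \<noteq> i" using MV(3)[of x] x K(1) sym[OF ijm(4)] by blast
        moreover have "x \<in> M" using x(1) K(1) by blast
        ultimately show False
          using no_P3_P2[of i m x r r'] MV[of r] MV[of r'] NV[of r] NV[of r'] MV[of x] mK[of x]
            not_sym[OF isolated[OF nK(1) x(1)]] not_sym[OF isolated[OF nK(2) x(1)]]
            x ijm(1,3,5) rr' r by simp
      qed
    qed
    have K'P: "E x p" if "x \<in> K'" "p \<in> P" for x p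
    proof (rule ccontr)
      assume "\<not> E x p"
      have "E x y" using cliqueD[OF K(2), of x y] that(1) y(1) unfolding K'_def by simp
      moreover have "x \<in> M" "p \<in> N - M" "p \<in> N" "\<not> E p y"
        using that K(1) not_sym[of y p] unfolding K'_def P_def by auto
      ultimately show False
        using no_P3_P2[of i j p x y] not_sym[OF \<open>\<not> E x p\<close>] NM[of p] NV[of p] MV[of x] MV[OF yM]
          ijm(1,2,4) by simp
    qed
    have K'L: "\<not> E x l" if "x \<in> K'" "l \<in> L" for x l
      using isolated[of l x] that not_sym[of l x] unfolding K'_def L_def by blast
    have QL: "E q l" if "q \<in> Q" "l \<in> L" for q l
    proof (rule ccontr)
      assume "\<not> E q l"
      have "E m l" using that(2) unfolding L_def M_def N_def by blast
      moreover have "l \<noteq> i" using that(2) MV(3)[of l] sym[OF ijm(4)] unfolding L_def by blast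
      moreover have "q \<in> N" "l \<in> M" "\<not> E l y" "E y q"
        using that isolated[of l y] y(1) unfolding Q_def L_def by auto
      ultimately show False
        using no_P3_P2[of i m l y q] not_sym[OF \<open>\<not> E q l\<close>] NV[of q] NV[OF yN] MV[of l]
          ijm(1,3,5) by simp
    qed
    have QP: "\<not> E q p" if "q \<in> Q" "p \<in> P" for q p
      using that P3_freeD[OF P3N yN, of q p] yM unfolding Q_def P_def by blast
    have cQ: "clique Q"
      unfolding clique_def
    proof (intro ballI impI)
      fix a b assume "a \<in> Q" "b \<in> Q" "a \<noteq> b"
      then show "E a b"
        using P3_freeD[OF P3N, of a y b] sym[of y a] yN unfolding Q_def by blast
    qed
    have cK': "clique K'" using clique_subset[OF K(2)] unfolding K'_def by blast
    obtain Y where Y: "Y \<subseteq> L" "clique Y" "clique_bound L (card Y)"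
      using maximum_clique[OF fins(3)] .
    obtain Z where Z: "Z \<subseteq> P" "clique Z" "clique_bound P (card Z)"
      using maximum_clique[OF fins(4)] .
    have finYZ: "finite Y" "finite Z" using Y(1) Z(1) fins finite_subset by blast+
    have cK'Z: "clique (K' \<union> Z)" using cK' Z K'P by (intro clique_Un) auto
    have cQY: "clique (Q \<union> Y)" using cQ Y QL by (intro clique_Un) auto
    have K'Z: "card (K' \<union> Z) \<le> k" "card (K' \<union> Z) = card K' + card Z"
      using subW Z(1) disj finYZ fins
      by (intro clique_boundD[OF W(2) _ cK'Z] card_Un_disjoint; auto)+
    have QY: "card (Q \<union> Y) \<le> k"
      using subW Y(1) by (intro clique_boundD[OF W(2) _ cQY]) auto
    have "card Y \<le> card K"
      using Y(1,2) unfolding L_def by (intro clique_boundD[OF K(3)]) auto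
    also have "card K = card K' + 1"
      using y(1) fin(3) card_Suc_Diff1 unfolding K'_def by fastforce
    finally have YZ: "card Y + card Z \<le> k + 1" using K'Z by simp
    \<comment> \<open>Joining \<open>Z\<close> completely to \<open>Y\<close> keeps the colours that are left for \<open>L\<close> and \<open>P\<close> disjoint.\<close>
    define r where "r x v \<longleftrightarrow> E x v \<or> x \<in> Z \<and> v \<in> Y" for x v
    obtain f where f: "inj_on f (K' \<union> Z)" "f ` (K' \<union> Z) \<subseteq> {..<k + 1}"
      using card_le_inj[of "K' \<union> Z" "{..<k + 1}"] K'Z(1) fins(1) finYZ(2) by auto
    have "\<exists>g. inj_on g (Q \<union> Y) \<and> g ` (Q \<union> Y) \<subseteq> {..<k + 1} \<and>
        (\<forall>x\<in>K' \<union> Z. \<forall>v\<in>Q \<union> Y. r x v \<longrightarrow> f x \<noteq> g v)"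
    proof (rule two_clique_colouring[OF _ _ f])
      show "finite (K' \<union> Z)" "finite (Q \<union> Y)" using fins finYZ by auto
      fix S assume S: "S \<subseteq> Q \<union> Y" "S \<noteq> {}"
      let ?T = "{x \<in> K' \<union> Z. \<forall>v\<in>S. r x v}"
      have finS: "finite S" using S(1) fins(2) finYZ(1) finite_subset by blast
      have TQ: "?T \<subseteq> K'" if "v \<in> S" "v \<in> Q" for v
        using that not_sym[OF QP[of v]] Z(1) Y(1) disj(4) unfolding r_def by blast
      have TY: "?T \<subseteq> Z" if "v \<in> S" "v \<in> Y" for v
        using that K'L[of _ v] Y(1) Z(1) disj(3) unfolding r_def by blast
      consider "S \<subseteq> Q" | "S \<subseteq> Y" | a b where "a \<in> S" "a \<in> Q" "b \<in> S" "b \<in> Y"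
        using S(1) by blast
      then show "card S + card ?T \<le> k + 1"
      proof cases
        case 1
        then have TK: "?T \<subseteq> K'" using S(2) TQ by blast
        have "clique (S \<union> ?T)"
        proof (rule clique_Un)
          show "clique S" "clique ?T" using clique_subset cQ cK' 1 TK by blast+
          fix a b assume "a \<in> S" "b \<in> ?T" "a \<noteq> b"
          then have "r b a" "a \<notin> Y" using 1 Y(1) disj(4) by blast+
          then show "E a b" using sym[of b a] unfolding r_def by blast
        qed
        then have "card (S \<union> ?T) \<le> k"
          using 1 TK subW by (intro clique_boundD[OF W(2)]) auto
        moreover have "card (S \<union> ?T) = card S + card ?T"
          using 1 TK disj(1) finS fins(1) by (intro card_Un_disjoint) (auto intro: finite_subset)
        ultimately show ?thesis by simp
      next
        case 2
        then have "?T \<subseteq> Z" using S(2) TY by blast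
        then have "card ?T \<le> card Z" "card S \<le> card Y"
          using 2 finYZ by (auto intro: card_mono)
        then show ?thesis using YZ by simp
      next
        case 3
        then have "?T = {}" using TQ[of a] TY[of b] Z(1) disj(3) by blast
        then have "card ?T = 0" by (simp only: card.empty)
        moreover have "card S \<le> card (Q \<union> Y)" using S(1) fins finYZ by (intro card_mono) auto
        ultimately show ?thesis using QY by linarith
      qed
    qed
    then obtain g where g: "inj_on g (Q \<union> Y)" "g ` (Q \<union> Y) \<subseteq> {..<k + 1}"
        "\<forall>x\<in>K' \<union> Z. \<forall>v\<in>Q \<union> Y. r x v \<longrightarrow> f x \<noteq> g v" by blast
    have "card (g ` Y) = card Y" "card (f ` Z) = card Z"
      using f(1) g(1) by (auto intro!: card_image intro: inj_on_subset)
    then have bYZ: "clique_bound L (card (g ` Y))" "clique_bound P (card (f ` Z))"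
      using Y(3) Z(3) by simp_all
    have "L \<subseteq> M" "P \<subseteq> N" unfolding L_def P_def by auto
    then have P3LP: "P3_free L" "P3_free P"
      using P3_free_subset[OF P3M] P3_free_subset[OF P3N] by simp_all
    obtain hL where
        hL: "hL ` L \<subseteq> g ` Y" "\<forall>u\<in>L. \<forall>v\<in>L. E u v \<longrightarrow> hL u \<noteq> hL v"
      using P3_free_colouring_into[OF P3LP(1) fins(3) bYZ(1) finite_imageI[OF finYZ(1)]] by blast
    obtain hP where
        hP: "hP ` P \<subseteq> f ` Z" "\<forall>u\<in>P. \<forall>v\<in>P. E u v \<longrightarrow> hP u \<noteq> hP v"
      using P3_free_colouring_into[OF P3LP(2) fins(4) bYZ(2) finite_imageI[OF finYZ(2)]] by blast
    define c where "c v = (if v \<in> K' then f v else if v \<in> Q then g v else if v \<in> L then hL v else hP v)"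
      for v
    have cv: "v \<in> K' \<Longrightarrow> c v = f v" "v \<in> Q \<Longrightarrow> c v = g v" "v \<in> L \<Longrightarrow> c v = hL v" "v \<in> P \<Longrightarrow> c v = hP v"
      for v using disj unfolding c_def by auto
    have hLY: "\<exists>w\<in>Y. c v = g w" if "v \<in> L" for v using hL(1) that cv(3) by auto
    have hPZ: "\<exists>w\<in>Z. c v = f w" if "v \<in> P" for v using hP(1) that cv(4) by auto
    have half: "c u \<noteq> c v" if uv: "E u v" and
      ord: "u \<in> K' \<and> v \<in> K' \<union> Q \<union> L \<union> P \<or> u \<in> Q \<and> v \<in> Q \<union> L \<union> P \<or> u \<in> L \<and> v \<in> L \<union> P \<or> u \<in> P \<and> v \<in> P"
      for u v
    proof -
      have "u \<noteq> v" using uv irrefl by blast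
      consider "u \<in> K'" "v \<in> K'" | "u \<in> K'" "v \<in> Q" | "u \<in> K'" "v \<in> L" | "u \<in> K'" "v \<in> P"
        | "u \<in> Q" "v \<in> Q" | "u \<in> Q" "v \<in> L" | "u \<in> Q" "v \<in> P" | "u \<in> L" "v \<in> L"
        | "u \<in> L" "v \<in> P" | "u \<in> P" "v \<in> P"
        using ord by blast
      then show ?thesis
      proof cases
        case 1
        then show ?thesis using cv(1) inj_onD[OF f(1), of u v] \<open>u \<noteq> v\<close> by auto
      next
        case 2
        then show ?thesis using cv g(3) uv unfolding r_def by simp
      next
        case 3
        then show ?thesis using K'L uv by blast
      next
        case 4
        then obtain w where "w \<in> Z" "c v = f w" using hPZ by blast
        then show ?thesis using cv(1) 4 inj_onD[OF f(1), of u w] Z(1) disj(3) by auto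
      next
        case 5
        then show ?thesis using cv(2) inj_onD[OF g(1), of u v] \<open>u \<noteq> v\<close> by auto
      next
        case 6
        then obtain w where "w \<in> Y" "c v = g w" using hLY by blast
        then show ?thesis using cv(2) 6 inj_onD[OF g(1), of u w] Y(1) disj(4) by auto
      next
        case 7
        then show ?thesis using QP uv by blast
      next
        case 8
        then show ?thesis using cv(3) hL(2) uv by simp
      next
        case 9
        then obtain w w' where "w \<in> Y" "c u = g w" "w' \<in> Z" "c v = f w'" using hLY hPZ by blast
        then show ?thesis using g(3) unfolding r_def by (metis UnI2)
      next
        case 10
        then show ?thesis using cv(4) hP(2) uv by simp
      qed
    qed
    have "colourable (K' \<union> Q \<union> L \<union> P) (k + 1)"
      unfolding colourable_def
    proof (intro exI[of _ c] conjI ballI impI)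
      have "c v < k + 1" if "v \<in> K' \<union> Q \<union> L \<union> P" for v
        using that cv[of v] hLY[of v] hPZ[of v] f(2) g(2) by (auto simp: image_subset_iff)
      then show "c ` (K' \<union> Q \<union> L \<union> P) \<subseteq> {..<k + 1}" by blast
      fix u v assume uv: "u \<in> K' \<union> Q \<union> L \<union> P" "v \<in> K' \<union> Q \<union> L \<union> P" "E u v"
      then show "c u \<noteq> c v" using half[of u v] half[of v u] sym[OF uv(3)] by auto
    qed
    then have "colourable ((K' \<union> Q \<union> L \<union> P) \<union> (M \<inter> N)) (k + 1 + 1)"
      using R by (rule colourable_Un)
    then show ?thesis
      using yN K(1) unfolding K'_def Q_def L_def P_def by (elim colourable_mono) auto
  qed
qed

section \<open>Colouring by induction on the clique number\<close>

text \<open>Removing the vertices of \<open>A - {i}\<close> one at a time or in pairs, the set \<open>X J\<close> of vertices that miss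
  \<open>i\<close> but nothing in \<open>(A - {i}) - J\<close> has clique number at most \<open>v = card J + 1\<close>, because its cliques
  extend by \<open>(A - {i}) - J\<close>. A vertex \<open>j\<close> is removed from \<open>J\<close> at the cost of colouring the
  vertices of \<open>X J\<close> that miss \<open>j\<close>; this takes at most \<open>min v s\<close> colours unless they contain
  more than \<open>s\<close> pairwise adjacent ones. If this fails for every \<open>j\<close>, two vertices are removed
  together for \<open>k + 2 \<le> 2 * s\<close> colours.\<close>

lemma nonneighbourhood_colourable:
  assumes W: "W \<subseteq> V" "clique_bound W k"
    and A: "A \<subseteq> W" "clique A" "card A = k" "i \<in> A"
    and s: "k + 2 \<le> 2 * s"
  shows "colourable {x \<in> W. \<not> E i x} (\<Sum>v=1..k. min v s)"
proof -
  define L where "L = A - {i}"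
  define X where "X J = {x \<in> W. \<not> E i x \<and> (\<forall>l\<in>L - J. E l x)}" for J
  define M where "M j = {x \<in> W. \<not> E i x \<and> \<not> E j x}" for j
  have finW: "finite W" using W(1) finite_V finite_subset by blast
  have finA: "finite A" using A(1) finW finite_subset by blast
  have k: "k = card L + 1"
    using A(3,4) finA card_Suc_Diff1[of A i] unfolding L_def by simp
  have LA: "l \<in> V" "l \<in> W" "l \<in> A" "E i l" "E l i" if "l \<in> L" for l
    using that A W(1) cliqueD[OF A(2), of i l] cliqueD[OF A(2), of l i] unfolding L_def by auto
  have LL: "E l l'" if "l \<in> L" "l' \<in> L" "l \<noteq> l'" for l l'
    using cliqueD[OF A(2)] that unfolding L_def by auto
  have iV: "i \<in> V" using A(1,4) W(1) by blast
  have cL: "clique S" if "S \<subseteq> L" for S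
    using clique_subset[OF A(2)] that unfolding L_def by blast
  have XW: "X J \<subseteq> W" "finite (X J)" for J
    using finW unfolding X_def by auto
  have X_bound: "clique_bound (X J) (card J + 1)" if J: "J \<subseteq> L" for J
    unfolding clique_bound_def
  proof (intro allI impI)
    fix C assume C: "C \<subseteq> X J" "clique C"
    have "clique ((L - J) \<union> C)"
      using C cL[of "L - J"] by (intro clique_Un) (auto simp: X_def)
    then have "card ((L - J) \<union> C) \<le> k"
      using C(1) XW(1) LA(2) by (intro clique_boundD[OF W(2)]) blast+
    moreover have "(L - J) \<inter> C = {}" using C(1) irrefl unfolding X_def by blast
    then have "card ((L - J) \<union> C) = card (L - J) + card C"
      using finA finite_subset[OF C(1) XW(2)] unfolding L_def by (intro card_Un_disjoint) auto
    moreover have "card (L - J) + card J = card L"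
      using J finA finite_subset[of J L] card_Diff_subset[of J L] card_mono[of L J]
      unfolding L_def by auto
    ultimately show "card C \<le> card J + 1" using k by linarith
  qed
  have X_P3_free: "P3_free {x \<in> X J. \<not> E j x}" if "j \<in> L" for J j
    by (rule nonneighbours_of_edge_P3_free[OF iV LA(1)[OF that] LA(4)[OF that]])
      (use W(1) in \<open>auto simp: X_def\<close>)
  have "colourable (X J) (\<Sum>v=1..card J + 1. min v s)" if "J \<subseteq> L" for J
    using that
  proof (induction "card J" arbitrary: J rule: less_induct)
    case less
    note J = less.prems
    have finJ: "finite J" using J finA finite_subset unfolding L_def by blast
    consider (empty) "J = {}"
      | (single) j where "j \<in> J" "clique_bound {x \<in> X J. \<not> E j x} (min (card J + 1) s)"
      | (pair) "J \<noteq> {}" "\<forall>j\<in>J. \<not> clique_bound {x \<in> X J. \<not> E j x} (min (card J + 1) s)"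
      by blast
    then show ?case
    proof cases
      case empty
      have "\<not> E u v" if "u \<in> X {}" "v \<in> X {}" for u v
      proof
        assume uv: "E u v"
        then have "clique {u, v}" using sym[OF uv] unfolding clique_def by auto
        then have "card {u, v} \<le> 1"
          using that clique_boundD[OF X_bound[of "{}"], of "{u, v}"] by simp
        then show False using uv irrefl by (cases "u = v") auto
      qed
      then have "colourable (X {}) 1" by (rule edgeless_colourable)
      then show ?thesis using empty s by simp
    next
      case single
      have cJ: "card J = Suc (card (J - {j}))"
        using card.remove[OF finJ single(1)] .
      have "colourable (X (J - {j})) (\<Sum>v=1..card (J - {j}) + 1. min v s)"
        using J cJ by (intro less.hyps) auto
      moreover have "colourable {x \<in> X J. \<not> E j x} (min (card J + 1) s)"
        using J single XW(2)[of J] by (intro P3_free_colourable X_P3_free) auto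
      ultimately have "colourable (X (J - {j}) \<union> {x \<in> X J. \<not> E j x})
          ((\<Sum>v=1..card (J - {j}) + 1. min v s) + min (card J + 1) s)"
        by (rule colourable_Un)
      then show ?thesis
        by (rule colourable_mono) (auto simp: X_def cJ)
    next
      case pair
      \<comment> \<open>The clique \<open>K j\<close> is largest among all common non-neighbours of \<open>i\<close> and \<open>j\<close>, not just
        among those in \<open>X J\<close>: only then is it one of their components.\<close>
      have "\<exists>K. K \<subseteq> M j \<and> clique K \<and> clique_bound (M j) (card K) \<and> s < card K \<and> s < card J + 1"
        if j: "j \<in> J" for j
      proof -
        obtain C where C: "C \<subseteq> {x \<in> X J. \<not> E j x}" "clique C" "\<not> card C \<le> min (card J + 1) s"
          using pair(2) j unfolding clique_bound_def by blast
        have CJ: "card C \<le> card J + 1"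
          using C(1,2) clique_boundD[OF X_bound[OF J], of C] by blast
        have "finite (M j)" using finW unfolding M_def by simp
        then obtain K where K: "K \<subseteq> M j" "clique K" "clique_bound (M j) (card K)"
          by (rule maximum_clique)
        have "C \<subseteq> M j" using C(1) unfolding X_def M_def by blast
        then have "card C \<le> card K" using clique_boundD[OF K(3)] C(2) by blast
        then show ?thesis using K C(3) CJ by (intro exI[of _ K]) auto
      qed
      then obtain K where K: "\<And>j. j \<in> J \<Longrightarrow> K j \<subseteq> M j" "\<And>j. j \<in> J \<Longrightarrow> clique (K j)"
          "\<And>j. j \<in> J \<Longrightarrow> clique_bound (M j) (card (K j))" "\<And>j. j \<in> J \<Longrightarrow> s < card (K j)"
        and sJ: "\<And>j. j \<in> J \<Longrightarrow> s < card J + 1"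
        by metis
      have "\<exists>j\<in>J. \<exists>m\<in>J - {j}. \<exists>y\<in>K j. \<not> E m y"
      proof (rule ccontr)
        assume none: "\<not> ?thesis"
        \<comment> \<open>Otherwise all of \<open>J - {j}\<close> is complete to \<open>K j\<close>, and the union is a clique with at least
          \<open>(s - 1) + (s + 1)\<close> vertices, that is, more than \<open>k\<close>.\<close>
        obtain j where j: "j \<in> J" using pair(1) by blast
        have "clique ((J - {j}) \<union> K j)"
          using none j K(2) cL[OF order_trans[OF Diff_subset J]] by (intro clique_Un) auto
        then have "card ((J - {j}) \<union> K j) \<le> k"
          using J j K(1)[OF j] LA(2) by (intro clique_boundD[OF W(2)]) (auto simp: M_def)
        moreover have "(J - {j}) \<inter> K j = {}"
          using K(1)[OF j] J j LL unfolding M_def by blast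
        then have "card ((J - {j}) \<union> K j) = card (J - {j}) + card (K j)"
          using finJ finite_subset[OF K(1)[OF j]] finW unfolding M_def
          by (intro card_Un_disjoint) auto
        moreover have "card J = Suc (card (J - {j}))"
          using card.remove[OF finJ j] .
        ultimately show False using K(4)[OF j] sJ[OF j] s by linarith
      qed
      then obtain j m y where jm: "j \<in> J" "m \<in> J" "m \<noteq> j" "y \<in> K j" "\<not> E m y" by blast
      have jmL: "j \<in> L" "m \<in> L" using jm J by auto
      have cJ: "card J = card (J - {j, m}) + 2"
        using finJ jm card_Diff_subset[of "{j, m}" J] card_mono[of J "{j, m}"] by auto
      have "colourable (X (J - {j, m})) (\<Sum>v=1..card (J - {j, m}) + 1. min v s)"
        using J cJ by (intro less.hyps) auto
      moreover have "colourable (M j \<union> M m) (k + 2)"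
        using two_nonneighbourhoods_colourable[OF W iV LA(1)[OF jmL(1)] LA(1)[OF jmL(2)] LA(4)[OF jmL(1)]
            LA(4)[OF jmL(2)] LL[OF jmL jm(3)[symmetric]] M_def M_def K(1-3)[OF jm(1)] jm(4,5)] .
      ultimately have "colourable (X (J - {j, m}) \<union> (M j \<union> M m))
          ((\<Sum>v=1..card (J - {j, m}) + 1. min v s) + (k + 2))"
        by (rule colourable_Un)
      moreover have "X J \<subseteq> X (J - {j, m}) \<union> (M j \<union> M m)"
        unfolding X_def M_def by blast
      moreover have "(\<Sum>v=1..card (J - {j, m}) + 1. min v s) + (k + 2) \<le> (\<Sum>v=1..card J + 1. min v s)"
        using s sJ[OF jm(1)] by (simp add: cJ)
      ultimately show ?thesis by (rule colourable_mono)
    qed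
  qed
  from this[of L] show ?thesis unfolding X_def k by simp
qed

text \<open>With a largest clique \<open>A\<close> and \<open>i \<in> A\<close>, the neighbours of \<open>i\<close> have a smaller clique number, and
  the other vertices are coloured by the preceding lemma.\<close>

lemma colourable_of_clique_bound:
  assumes s: "\<And>n. n + 2 \<le> 2 * s n" and "W \<subseteq> V" "clique_bound W k"
  shows "colourable W (\<Sum>n=1..k. \<Sum>v=1..n. min v (s n))"
  using assms(2,3)
proof (induction k arbitrary: W)
  case 0
  have "W = {}"
  proof (rule ccontr)
    assume "W \<noteq> {}"
    then obtain x where "x \<in> W" by blast
    then show False using clique_boundD[OF 0(2), of "{x}"] by (simp add: clique_def)
  qed
  then show ?case by (simp add: colourable_def)
next
  case (Suc k)
  have finW: "finite W" using Suc.prems(1) finite_V finite_subset by blast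
  then obtain A where A: "A \<subseteq> W" "clique A" "clique_bound W (card A)"
    by (rule maximum_clique)
  have "card A \<le> Suc k" using clique_boundD[OF Suc.prems(2) A(1,2)] .
  then consider "card A \<le> k" | "card A = Suc k" by linarith
  then show ?case
  proof cases
    case 1
    then have "clique_bound W k" using clique_bound_mono[OF A(3)] by blast
    then have "colourable W (\<Sum>n=1..k. \<Sum>v=1..n. min v (s n))" using Suc by blast
    then show ?thesis by (rule colourable_mono) auto
  next
    case 2
    then obtain i where i: "i \<in> A" by (metis card.empty equals0I nat.distinct(1))
    have "clique_bound {x \<in> W. E i x} k"
      unfolding clique_bound_def
    proof (intro allI impI)
      fix C assume C: "C \<subseteq> {x \<in> W. E i x}" "clique C"
      have "clique ({i} \<union> C)" using C by (intro clique_Un) (auto simp: clique_def)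
      then have "card ({i} \<union> C) \<le> Suc k"
        using C(1) i A(1) by (intro clique_boundD[OF Suc.prems(2)]) auto
      moreover have "i \<notin> C" "finite C"
        using C(1) irrefl finite_subset[of C W] finW by auto
      ultimately show "card C \<le> k" by simp
    qed
    then have "colourable {x \<in> W. E i x} (\<Sum>n=1..k. \<Sum>v=1..n. min v (s n))"
      using Suc.prems(1) by (intro Suc.IH) auto
    moreover have "colourable {x \<in> W. \<not> E i x} (\<Sum>v=1..Suc k. min v (s (Suc k)))"
      using Suc.prems A i 2 s by (intro nonneighbourhood_colourable[of W "Suc k" A]) auto
    ultimately have "colourable ({x \<in> W. E i x} \<union> {x \<in> W. \<not> E i x})
        ((\<Sum>n=1..k. \<Sum>v=1..n. min v (s n)) + (\<Sum>v=1..Suc k. min v (s (Suc k))))"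
      by (rule colourable_Un)
    then show ?thesis by (rule colourable_mono) auto
  qed
qed

end

section \<open>Induced copies of \<open>P\<^sub>2 \<union> P\<^sub>3\<close>\<close>

lemma parcs_P2_union_P3:
  "pverts P2_union_P3 = {Inl 0, Inl 1, Inr 0, Inr 1, Inr 2}"
  "parcs P2_union_P3 = {(Inl 0, Inl 1), (Inl 1, Inl 0), (Inr 0, Inr 1), (Inr 1, Inr 0),
     (Inr 1, Inr 2), (Inr 2, Inr 1)}"
proof -
  have "{..<2::nat} = {0, 1}" "{..<3::nat} = {0, 1, 2}" by auto
  then show "pverts P2_union_P3 = {Inl 0, Inl 1, Inr 0, Inr 1, Inr 2}"
    unfolding P2_union_P3_def disjoint_union_graph_def path_graph_def by auto
  have "{(i, j). i < 2 \<and> j < 2 \<and> (j = Suc i \<or> i = Suc j)} = {(0, 1), (1, 0)}"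
    "{(i, j). i < 3 \<and> j < 3 \<and> (j = Suc i \<or> i = Suc j)} = {(0, 1), (1, 0), (1, 2), (2, 1)}"
    by auto
  then show "parcs P2_union_P3 = {(Inl 0, Inl 1), (Inl 1, Inl 0), (Inr 0, Inr 1), (Inr 1, Inr 0),
     (Inr 1, Inr 2), (Inr 2, Inr 1)}"
    unfolding P2_union_P3_def disjoint_union_graph_def path_graph_def by auto
qed

lemma induced_P2_union_P3:
  assumes G: "pair_graph G"
    and V: "a \<in> pverts G" "b \<in> pverts G" "c \<in> pverts G" "d \<in> pverts G" "e \<in> pverts G"
    and adj: "(a, b) \<in> parcs G" "(c, d) \<in> parcs G" "(d, e) \<in> parcs G"
    and non: "c \<noteq> e" "(c, e) \<notin> parcs G" "(a, c) \<notin> parcs G" "(a, d) \<notin> parcs G" "(a, e) \<notin> parcs G"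
      "(b, c) \<notin> parcs G" "(b, d) \<notin> parcs G" "(b, e) \<notin> parcs G"
  shows "\<not> induced_free P2_union_P3 G"
proof -
  interpret G: pair_graph G by fact
  have sym: "(v, u) \<in> parcs G" if "(u, v) \<in> parcs G" for u v
    using that G.pair_sym_arcs by (auto simp: symmetric_def elim: symE)
  have irrefl: "(u, u) \<notin> parcs G" for u using G.pair_no_loops by force
  have dist: "distinct [a, b, c, d, e]"
    using adj non sym irrefl by auto
  define S where "S = {a, b, c, d, e}"
  define B where "B = {(a, b), (b, a), (c, d), (d, c), (d, e), (e, d)}"
  define H where "H = \<lparr>pverts = S, parcs = B\<rparr>"
  have B: "B = {p \<in> parcs G. fst p \<in> S \<and> snd p \<in> S}"
  proof
    show "B \<subseteq> {p \<in> parcs G. fst p \<in> S \<and> snd p \<in> S}"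
      using adj sym unfolding B_def S_def by auto
    have "(u, v) \<in> B" if "(u, v) \<in> parcs G" "u \<in> S" "v \<in> S" for u v
      using that non sym[OF that(1)] irrefl unfolding B_def S_def by auto
    then show "{p \<in> parcs G. fst p \<in> S \<and> snd p \<in> S} \<subseteq> B" by auto
  qed
  have wfH: "wf_digraph (with_proj H)"
    by unfold_locales (auto simp: H_def B)
  have "induced_subgraph (with_proj H) (with_proj G)"
    unfolding induced_subgraph_def subgraph_def compatible_def
    using V wfH G.wf_digraph_axioms by (auto simp: H_def B S_def)
  moreover have "digraph_iso (with_proj H) (with_proj P2_union_P3)"
  proof -
    define h :: "'a \<Rightarrow> nat + nat" where
      "h x = (if x = a then Inl 0 else if x = b then Inl 1 else if x = c then Inr 0
              else if x = d then Inr 1 else Inr 2)" for x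
    have h: "h a = Inl 0" "h b = Inl 1" "h c = Inr 0" "h d = Inr 1" "h e = Inr 2"
      using dist unfolding h_def by auto
    have inj: "inj_on h S" using h unfolding S_def by (auto simp: inj_on_def)
    define f where "f = \<lparr>iso_verts = h, iso_arcs = map_prod h h, iso_head = snd, iso_tail = fst\<rparr>"
    have "inj_on (map_prod h h) B"
      using map_prod_inj_on[OF inj inj] by (rule inj_on_subset) (auto simp: B)
    then have "pre_digraph.digraph_isomorphism (with_proj H) f"
      using wfH inj unfolding pre_digraph.digraph_isomorphism_def f_def by (auto simp: H_def)
    moreover have "with_proj P2_union_P3 = app_iso f (with_proj H)"
      unfolding app_iso_def f_def with_proj_def H_def parcs_P2_union_P3
      by (simp add: S_def B_def h insert_commute)
    ultimately show ?thesis unfolding digraph_iso_def by blast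
  qed
  ultimately show ?thesis unfolding induced_free_def by blast
qed

lemma P2_union_P3_free_graph_of_pair_graph:
  assumes "pair_graph G" "induced_free P2_union_P3 G"
  shows "P2_union_P3_free_graph (\<lambda>u v. (u, v) \<in> parcs G) (pverts G)"
proof -
  interpret G: pair_graph G by fact
  show ?thesis
  proof
    show "(v, u) \<in> parcs G" if "(u, v) \<in> parcs G" for u v
      using that G.pair_sym_arcs by (auto simp: symmetric_def elim: symE)
    show "(u, u) \<notin> parcs G" for u using G.pair_no_loops by force
    show "finite (pverts G)" by (rule G.pair_finite_verts)
  qed (use induced_P2_union_P3[OF assms(1)] assms(2) in blast)
qed

section \<open>The numerical bound\<close>

lemma sum_min_closed_form:
  assumes "s \<le> n"
  shows "real (\<Sum>v=1..n. min v s) = real s * (2 * real n + 1 - real s) / 2"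
  using assms
proof (induction n rule: dec_induct)
  case base
  have "(\<Sum>v=1..s. min v s) = \<Sum>{1..s}" by (intro sum.cong) auto
  moreover have "real (\<Sum>{1..s}) = real s * (real s + 1) / 2"
    by (induction s) (auto simp: field_simps)
  ultimately show ?case by simp
next
  case (step n)
  then show ?case by (simp add: field_simps)
qed

lemma real_choose_3: "real (n choose 3) = real n * (real n - 1) * (real n - 2) / 6"
  by (simp add: binomial_gbinomial gbinomial_prod_rev numeral_3_eq_3)

lemma U8_closed_form:
  "U8 k = real k ^ 3 / 8 + 5 * real k ^ 2 / 4 - 4 * real k + 8 - (if odd k then (real k - 6) / 8 else 0)"
  unfolding U8_def S_term_def real_choose_3
  by (simp add: field_simps power2_eq_square power3_eq_cube)

text \<open>The choice \<open>s n = (n + 8) div 2\<close> in \<open>colourable_of_clique_bound\<close> gives exactly the bound \<open>U8\<close>.\<close>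

lemma sum_min_eq_U8:
  assumes "k \<ge> 8"
  shows "real (\<Sum>n=1..k. \<Sum>v=1..n. min v ((n + 8) div 2)) = U8 k"
  using assms
proof (induction k rule: dec_induct)
  case base
  have "(\<Sum>n=1..8. \<Sum>v=1..n. min v ((n + 8) div 2)) = (120 :: nat)" by code_simp
  then show ?case by (simp add: U8_closed_form)
next
  case (step k)
  have "real (\<Sum>v=1..Suc k. min v ((Suc k + 8) div 2)) = U8 (Suc k) - U8 k"
  proof (cases "even k")
    case True
    then obtain q where q: "k = 2 * q" by blast
    then have eq: "(Suc k + 8) div 2 = q + 4" by simp
    have "real (\<Sum>v=1..Suc k. min v ((Suc k + 8) div 2))
        = real (q + 4) * (2 * real (Suc k) + 1 - real (q + 4)) / 2"
      unfolding eq using step(1) q by (intro sum_min_closed_form) simp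
    then show ?thesis unfolding U8_closed_form
      by (simp add: q field_simps power2_eq_square power3_eq_cube del: sum.cl_ivl_Suc of_nat_sum)
  next
    case False
    then obtain q where q: "k = 2 * q + 1" by (elim oddE)
    then have eq: "(Suc k + 8) div 2 = q + 5" by simp
    have "real (\<Sum>v=1..Suc k. min v ((Suc k + 8) div 2))
        = real (q + 5) * (2 * real (Suc k) + 1 - real (q + 5)) / 2"
      unfolding eq using step(1) q by (intro sum_min_closed_form) simp
    then show ?thesis unfolding U8_closed_form
      by (simp add: q field_simps power2_eq_square power3_eq_cube del: sum.cl_ivl_Suc of_nat_sum)
  qed
  then show ?case using step.IH by simp
qed

section \<open>Chromatic number and clique number\<close>

theorem theorem1p2:
  fixes k :: nat
  assumes "k \<ge> 8"
  shows "(\<forall>G :: 'a pair_pre_digraph.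
            pair_graph G \<and> induced_free P2_union_P3 G \<and> clique_number G = k
              \<longrightarrow> real (chromatic_number G) \<le> U8 k)
       \<and> U8 k \<le> real k ^ 3 / 8 + 5 * real k ^ 2 / 4 - 4 * real k + 8
       \<and> (even k \<longrightarrow> U8 k = real k ^ 3 / 8 + 5 * real k ^ 2 / 4 - 4 * real k + 8)
       \<and> (odd k \<longrightarrow>
            real k ^ 3 / 8 + 5 * real k ^ 2 / 4 - 4 * real k + 8 - U8 k = (real k - 6) / 8)"
proof (intro conjI allI impI)
  fix G :: "'a pair_pre_digraph"
  assume "pair_graph G \<and> induced_free P2_union_P3 G \<and> clique_number G = k"
  then have G: "pair_graph G" "induced_free P2_union_P3 G" "clique_number G = k" by auto
  interpret gr: pair_graph G by (rule G(1))
  interpret P2_union_P3_free_graph "\<lambda>u v. (u, v) \<in> parcs G" "pverts G"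
    using G(1,2) by (rule P2_union_P3_free_graph_of_pair_graph)
  let ?n = "\<Sum>n=1..k. \<Sum>v=1..n. min v ((n + 8) div 2)"
  have "{K. is_clique G K} \<subseteq> Pow (pverts G)" unfolding is_clique_def by blast
  then have "finite {K. is_clique G K}" using finite_V by (simp add: finite_subset)
  then have "card K \<le> k" if "is_clique G K" for K
    using that unfolding G(3)[symmetric] clique_number_def by (intro Max_ge) auto
  then have "clique_bound (pverts G) k"
    unfolding clique_bound_def clique_def is_clique_def by simp
  then have "colourable (pverts G) ?n"
    by (intro colourable_of_clique_bound) simp_all
  then obtain c where c: "c ` pverts G \<subseteq> {..<?n}"
      "\<forall>u\<in>pverts G. \<forall>v\<in>pverts G. (u, v) \<in> parcs G \<longrightarrow> c u \<noteq> c v"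
    unfolding colourable_def by blast
  have "c u \<noteq> c v" if "(u, v) \<in> parcs G" for u v
    using c(2) that gr.in_arcsD1[OF that] gr.in_arcsD2[OF that] by simp
  then have "proper_colouring G ?n c"
    using c(1) unfolding proper_colouring_def by auto
  then have "chromatic_number G \<le> ?n"
    unfolding chromatic_number_def by (intro Least_le exI)
  then show "real (chromatic_number G) \<le> U8 k"
    using sum_min_eq_U8[OF assms] by linarith
next
  show "U8 k \<le> real k ^ 3 / 8 + 5 * real k ^ 2 / 4 - 4 * real k + 8"
    using assms by (simp add: U8_closed_form)
qed (simp_all add: U8_closed_form)

end
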